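(* Let $(X,\preceq)$ be a locally compact, second-countable and order-connected Hausdorff topological $\wedge$-semilattice. Then there exists a metric on $X$ that induces the topology of $X$ and is radially convex relative to $\preceq$.
   Context: A Hausdorff topological $\wedge$-semilattice is a poset $(X,\preceq)$ in which the greatest lower bound $x\wedge y$ exists for all $x,y\in X$, where $X$ carries a Hausdorff topology such that $(x,y)\mapsto x\wedge y$ is continuous from $X\times X$ into $X$. Writing $x^{\downarrow}:=\{z\in X:z\preceq x\}$ and $x^{\uparrow}:=\{z\in X:x\preceq z\}$, $(X,\preceq)$ is order-connected if $x^{\uparrow}\cap y^{\downarrow}$ is a connected subset of $X$ for all $x,y\in X$ with $x\preceq y$. A metric $d$ on $X$ is radially convex relative to $\preceq$ if $x\preceq y\preceq z$ implies $d(x,z)\geq\max\{d(x,y),d(y,z)\}$. *)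

theory Defs
  imports "HOL-Analysis.Analysis"
begin

definition order_connected :: "'a::{order, topological_space} itself \<Rightarrow> bool" where
  "order_connected _ \<longleftrightarrow> (\<forall>x y :: 'a. x \<le> y \<longrightarrow> connected ({x..} \<inter> {..y}))"

definition radially_convex :: "('a::order \<Rightarrow> 'a \<Rightarrow> real) \<Rightarrow> bool" where
  "radially_convex d \<longleftrightarrow> (\<forall>x y z. x \<le> y \<and> y \<le> z \<longrightarrow> d x z \<ge> max (d x y) (d y z))"

end

theory Submission imports Defs begin

text \<open>If $f_0, f_1, \dots$ are monotone continuous functions from $X$ to $[0,1]$, then
  $d(x,y) = \sum_n 2^{-n} |f_n(x) - f_n(y)|$ satisfies the inequality of radial convexity, term by
  term, and it induces the topology of $X$ as soon as finitely many $f_n$ can always tell a point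
  from the complement of a given neighbourhood. So the task is to find enough monotone continuous
  functions; three observations supply them.

  First, the semilattice structure makes monotone functions. For a continuous $g \ge 0$ with compact
  support, put $F(x) = \sup_{z \le x} g(z) = \sup_w g(w \wedge x)$. The first form shows that $F$ is
  monotone; the second, a supremum of continuous functions, that $F$ is lower semicontinuous; and
  upper semicontinuity holds because the order is closed and $g$ lives on a compact set
  (\<open>isotone_sup_below\<close>). Choosing $g$ with $g(u) = 1$ and $g = 0$ on the closed set of elements
  below $v$ separates $u$ from $v$ whenever $u \not\le v$ (\<open>isotone_maps_separate\<close>).

  Secondly, order-connectedness reduces the separation of $x$ from everything outside a
  neighbourhood $V$ to the separation of $x$ from the frontier of $V$, which may be taken compact.
  For $y \notin V$ the intervals $[x \wedge y, x]$ and $[x \wedge y, y]$ form a connected set that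
  joins $x$ to $y$ and hence meet the frontier at some $z$. A monotone $f$ with $f(z) > f(x)$ transfers its
  gap from $z$ to $y$ if $z \le y$. If $z \le x$, a monotone $f$ with $f(z) < f(x)$ need not
  distinguish $y$ from $x$, but the equally monotone map $f(x \wedge \cdot)$ does, since
  $x \wedge y \le x \wedge z$. Finitely many such functions suffice by compactness
  (\<open>isotone_maps_determine_topology\<close>).

  Thirdly, second countability allows one to pass to a countable subfamily
  (\<open>countable_determining_subfamily\<close>).\<close>

section \<open>Families of functions that determine a topology\<close>

definition isotone_maps :: "('a::{order, topological_space} \<Rightarrow> real) set" where
  "isotone_maps = {f. continuous_on UNIV f \<and> mono f \<and> range f \<subseteq> {0..1}}"

text \<open>For a family of continuous functions this says that the topology is the initial one.\<close>

definition determines_topology :: "('a::topological_space \<Rightarrow> real) set \<Rightarrow> bool" where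
  "determines_topology F \<longleftrightarrow>
    (\<forall>x U. open U \<and> x \<in> U \<longrightarrow>
      (\<exists>N e. N \<subseteq> F \<and> finite N \<and> e > 0 \<and> {y. \<forall>f\<in>N. \<bar>f y - f x\<bar> < e} \<subseteq> U))"

lemma determines_topologyD:
  assumes "determines_topology F" "open U" "x \<in> U"
  obtains N e where "N \<subseteq> F" "finite N" "e > 0" "{y. \<forall>f\<in>N. \<bar>f y - f x\<bar> < e} \<subseteq> U"
proof -
  have "\<exists>N e. N \<subseteq> F \<and> finite N \<and> e > 0 \<and> {y. \<forall>f\<in>N. \<bar>f y - f x\<bar> < e} \<subseteq> U"
    using assms by (simp only: determines_topology_def)
  then show thesis by (elim exE conjE) (rule that)
qed

lemma determines_topology_mono:
  fixes F :: "('a::topological_space \<Rightarrow> real) set"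
  assumes "determines_topology F" "F \<subseteq> G"
  shows "determines_topology G"
  unfolding determines_topology_def
proof clarify
  fix x :: 'a and U assume "open U" "x \<in> U"
  with assms(1) obtain N e where
    "N \<subseteq> F" "finite N" "e > 0" "{y. \<forall>f\<in>N. \<bar>f y - f x\<bar> < e} \<subseteq> U"
    by (rule determines_topologyD)
  with assms(2) show "\<exists>N e. N \<subseteq> G \<and> finite N \<and> e > 0 \<and> {y. \<forall>f\<in>N. \<bar>f y - f x\<bar> < e} \<subseteq> U"
    by (intro exI[of _ N] exI[of _ e]) auto
qed

text \<open>The Lindelof property: each member of a countable basis is covered by countably many
  of the sets that are cut out by finitely many functions, and only these functions are kept.\<close>

lemma countable_determining_subfamily:
  fixes F :: "('a::second_countable_topology \<Rightarrow> real) set"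
  assumes det: "determines_topology F" and cont: "\<And>f. f \<in> F \<Longrightarrow> continuous_on UNIV f"
  obtains C where "C \<subseteq> F" "countable C" "determines_topology C"
proof -
  define W where "W x N e = {y. \<forall>f\<in>N. \<bar>f y - f x\<bar> < e}" for x :: 'a and N :: "('a \<Rightarrow> real) set" and e :: real
  \<comment> \<open>The centre of \<^term>\<open>A\<close> must not depend on the point to be separated; otherwise uncountably many
    finite families would be needed.\<close>
  define good where "good U A \<longleftrightarrow> (\<exists>x N e. A = W x N e \<and> N \<subseteq> F \<and> finite N \<and> e > 0 \<and> W x N e \<subseteq> U)" for U A
  obtain B :: "'a set set" where B: "countable B" "topological_basis B"
    using ex_countable_basis by blast
  have ex: "\<exists>T. countable T \<and> (\<forall>A\<in>T. good U A) \<and> \<Union>T = U" if "open U" for U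
  proof -
    have "open A" if "good U A" for A
    proof -
      from that obtain x N e where A: "A = W x N e" "N \<subseteq> F" "finite N" by (auto simp: good_def)
      have "A = (\<Inter>f\<in>N. {y. \<bar>f y - f x\<bar> < e})" by (auto simp: A W_def)
      then show ?thesis
        using A cont by (auto intro!: open_INT open_Collect_less continuous_intros)
    qed
    then obtain T where T: "T \<subseteq> {A. good U A}" "countable T" "\<Union>T = \<Union>{A. good U A}"
      using Lindelof[of "{A. good U A}"] by auto
    have "U \<subseteq> \<Union>{A. good U A}"
    proof
      fix x assume "x \<in> U"
      with det \<open>open U\<close> obtain N e where "N \<subseteq> F" "finite N" "e > 0" "W x N e \<subseteq> U"
        unfolding W_def by (rule determines_topologyD)
      then have "good U (W x N e)" "x \<in> W x N e" by (auto simp: good_def W_def)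
      then show "x \<in> \<Union>{A. good U A}" by blast
    qed
    moreover have "\<Union>{A. good U A} \<subseteq> U" by (auto simp: good_def)
    ultimately have "\<Union>T = U" using T(3) by simp
    then show ?thesis using T(1,2) by (intro exI[of _ T]) auto
  qed
  then obtain T where T: "\<And>U. open U \<Longrightarrow> countable (T U)"
      "\<And>U A. open U \<Longrightarrow> A \<in> T U \<Longrightarrow> good U A" "\<And>U. open U \<Longrightarrow> \<Union>(T U) = U"
    by metis
  have "\<forall>A. \<exists>x N e. (\<exists>U. good U A) \<longrightarrow> A = W x N e \<and> N \<subseteq> F \<and> finite N \<and> e > 0"
    unfolding good_def by blast
  then obtain X N e where sel: "\<And>U A. good U A \<Longrightarrow> A = W (X A) (N A) (e A) \<and> N A \<subseteq> F \<and> finite (N A) \<and> e A > 0"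
    by metis
  have opB: "open U" if "U \<in> B" for U using B that topological_basis_open by blast
  define C where "C = (\<Union>U\<in>B. \<Union>A\<in>T U. N A)"
  have good: "good U A" if "U \<in> B" "A \<in> T U" for U A using T(2) opB that by blast
  have "N A \<subseteq> F" "finite (N A)" if "U \<in> B" "A \<in> T U" for U A
    using sel[OF good[OF that]] by blast+
  then have "C \<subseteq> F" "countable C"
    using B(1) T(1) opB by (auto simp: C_def intro!: countable_UN intro: countable_finite)
  moreover have "determines_topology C"
    unfolding determines_topology_def
  proof clarify
    fix p :: 'a and U assume "open U" "p \<in> U"
    then obtain U' where U': "U' \<in> B" "p \<in> U'" "U' \<subseteq> U"
      using B(2) by (metis topological_basisE)
    with T(3) opB obtain A where A: "A \<in> T U'" "p \<in> A" by blast
    with U' have "good U' A" by (intro good)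
    note s = sel[OF this]
    \<comment> \<open>The point \<^term>\<open>p\<close> need not be the centre of \<^term>\<open>A\<close>; \<^term>\<open>e A\<close> shrinks by the distance to the centre.\<close>
    define \<delta> where "\<delta> = Min (insert 1 ((\<lambda>f. e A - \<bar>f p - f (X A)\<bar>) ` N A))"
    have "p \<in> W (X A) (N A) (e A)" using A s by simp
    then have "\<delta> > 0" using s by (auto simp: \<delta>_def W_def)
    moreover have "{y. \<forall>f\<in>N A. \<bar>f y - f p\<bar> < \<delta>} \<subseteq> A"
    proof clarify
      fix y assume y: "\<forall>f\<in>N A. \<bar>f y - f p\<bar> < \<delta>"
      have "\<bar>f y - f (X A)\<bar> < e A" if "f \<in> N A" for f
      proof -
        have "\<delta> \<le> e A - \<bar>f p - f (X A)\<bar>" using s that unfolding \<delta>_def by (intro Min_le) auto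
        moreover have "\<bar>f y - f p\<bar> < \<delta>" using y that by blast
        ultimately show ?thesis by linarith
      qed
      then have "y \<in> W (X A) (N A) (e A)" by (simp add: W_def)
      then show "y \<in> A" using s by simp
    qed
    moreover have "A \<subseteq> U" using \<open>good U' A\<close> U' by (auto simp: good_def)
    moreover have "N A \<subseteq> C" using U' A by (auto simp: C_def)
    ultimately show "\<exists>N e. N \<subseteq> C \<and> finite N \<and> e > 0 \<and> {y. \<forall>f\<in>N. \<bar>f y - f p\<bar> < e} \<subseteq> U"
      using s by (meson order_trans)
  qed
  ultimately show ?thesis using that by blast
qed

section \<open>Monotone functions on a locally compact semilattice\<close>

lemma Hausdorff_space_euclidean_t2: "Hausdorff_space (euclidean :: 'a::t2_space topology)"
  unfolding Hausdorff_space_def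
proof (intro allI impI)
  fix x y :: 'a
  assume "x \<in> topspace euclidean \<and> y \<in> topspace euclidean \<and> x \<noteq> y"
  then have "\<exists>U V. open U \<and> open V \<and> x \<in> U \<and> y \<in> V \<and> U \<inter> V = {}"
    by (intro hausdorff) simp
  then show "\<exists>U V. openin euclidean U \<and> openin euclidean V \<and> x \<in> U \<and> y \<in> V \<and> disjnt U V"
    by (simp add: disjnt_def flip: open_openin)
qed

lemma continuous_on_inf_right:
  assumes "continuous_on UNIV (\<lambda>(x, y). inf x y :: 'a::{semilattice_inf, topological_space})"
  shows "continuous_on UNIV (inf (w :: 'a))"
proof -
  have "continuous_on UNIV ((\<lambda>(x, y). inf x y :: 'a) \<circ> (\<lambda>x. (w, x)))"
    by (intro continuous_on_compose continuous_intros continuous_on_subset[OF assms]) auto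
  then show ?thesis by (simp add: o_def)
qed

lemma closed_order_graph:
  assumes "continuous_on UNIV (\<lambda>(x, y). inf x y :: 'a::{semilattice_inf, t2_space})"
  shows "closed {(x :: 'a, y). y \<le> x}"
proof -
  have "closed {p :: 'a \<times> 'a. (\<lambda>(x, y). inf x y) p = snd p}"
    by (intro closed_Collect_eq assms continuous_intros)
  moreover have "{p :: 'a \<times> 'a. (\<lambda>(x, y). inf x y) p = snd p} = {(x, y). y \<le> x}"
    by (auto simp: inf.absorb_iff2 inf.commute)
  ultimately show ?thesis by simp
qed

text \<open>The values of $g$ below $x$ are the numbers $g(w \wedge x)$, which is why the supremum over all
  elements below $x$ depends continuously on $x$, although these elements themselves vary.\<close>

lemma isotone_sup_below:
  fixes g :: "'a::{semilattice_inf, t2_space} \<Rightarrow> real"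
  assumes inf: "continuous_on UNIV (\<lambda>(x, y). inf x y :: 'a)"
    and g: "continuous_on UNIV g" "range g \<subseteq> {0..1}"
    and K: "compact K" "\<And>x. x \<notin> K \<Longrightarrow> g x = 0"
  shows "(\<lambda>x. SUP w. g (inf w x)) \<in> isotone_maps"
proof -
  define F where "F x = (SUP w. g (inf w x))" for x
  have g01: "0 \<le> g x" "g x \<le> 1" for x using g(2) by (auto simp: subset_iff)
  have bdd: "bdd_above (range (\<lambda>w. g (inf w x)))" for x
    by (auto intro!: bdd_aboveI[of _ 1] g01)
  have upper: "g z \<le> F x" if "z \<le> x" for z x
    using cSUP_upper[OF UNIV_I bdd, of z x] that by (simp add: F_def inf_absorb1)
  have least: "F x \<le> c" if "\<And>z. z \<le> x \<Longrightarrow> g z \<le> c" for x c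
    unfolding F_def by (rule cSUP_least) (auto intro: that)
  have "mono F" by (intro monoI least upper) (meson order_trans)
  moreover have "0 \<le> F x" "F x \<le> 1" for x
    using upper[of x x] g01[of x] by (auto intro: least g01)
  then have "range F \<subseteq> {0..1}" by auto
  moreover have "continuous_on UNIV F"
  proof -
    have "(F \<longlongrightarrow> F x) (at x)" for x
    proof (rule order_tendstoI)
      fix a assume "a < F x"
      then obtain w where w: "a < g (inf w x)"
        unfolding F_def by (subst (asm) less_cSUP_iff[OF _ bdd]) auto
      have "continuous_on UNIV (\<lambda>y. g (inf w y))"
        by (rule continuous_on_compose2[OF g(1) continuous_on_inf_right[OF inf]]) simp
      then have "open {y. a < g (inf w y)}" by (intro open_Collect_less continuous_intros)
      then have "eventually (\<lambda>y. a < g (inf w y)) (at x)"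
        using w by (simp add: eventually_at_topological) blast
      then show "eventually (\<lambda>y. a < F y) (at x)"
        by eventually_elim (meson inf_le2 less_le_trans upper)
    next
      fix a assume "F x < a"
      then obtain c where c: "F x < c" "c < a" using dense by blast
      \<comment> \<open>As \<^term>\<open>c\<close> is positive, \<^term>\<open>g\<close> reaches \<^term>\<open>c\<close> only on a compact set, no point
        of which is below \<^term>\<open>x\<close>; closedness of the order carries this over to the points near \<^term>\<open>x\<close>.\<close>
      have "0 < c" using \<open>0 \<le> F x\<close> c by linarith
      define C where "C = K \<inter> {z. c \<le> g z}"
      have "compact C" unfolding C_def
        by (intro compact_Int_closed K closed_Collect_le g continuous_intros)
      moreover have "{x} \<times> C \<subseteq> - {(x, z). z \<le> x}"
        using upper c by (fastforce simp: C_def)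
      ultimately have "\<exists>X. x \<in> X \<and> open X \<and> X \<times> C \<subseteq> - {(x, z). z \<le> x}"
        by (rule Elementary_Topology.tube_lemma[OF _ open_Compl[OF closed_order_graph[OF inf]]])
      then obtain X where X: "x \<in> X" "open X" "X \<times> C \<subseteq> - {(x, z). z \<le> x}"
        by (elim exE conjE)
      have le: "F y \<le> c" if "y \<in> X" for y
      proof (rule least)
        fix z assume "z \<le> y"
        then have "z \<notin> C" using X that by auto
        then show "g z \<le> c" using K(2)[of z] \<open>0 < c\<close> by (auto simp: C_def)
      qed
      have "eventually (\<lambda>y. y \<in> X) (at x)"
        using X(2,1) by (rule eventually_at_in_open')
      then show "eventually (\<lambda>y. F y < a) (at x)"
        by eventually_elim (rule le_less_trans[OF le c(2)])
    qed
    then show ?thesis by (simp add: continuous_on_def)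
  qed
  ultimately show ?thesis by (simp add: isotone_maps_def flip: F_def)
qed

text \<open>The set of elements below $v$ is closed and omits $u$, so complete regularity provides a
  function $g$ with compact support that is $1$ at $u$ and vanishes below $v$; its supremum over
  the elements below $v$ is then $0$.\<close>

lemma isotone_maps_separate:
  fixes u v :: "'a::{semilattice_inf, t2_space}"
  assumes inf: "continuous_on UNIV (\<lambda>(x, y). inf x y :: 'a)"
    and lc: "locally_compact_space (euclidean :: 'a topology)"
    and "\<not> u \<le> v"
  obtains f where "f \<in> isotone_maps" "f v < f u"
proof -
  have hd: "Hausdorff_space (euclidean :: 'a topology)"
    by (rule Hausdorff_space_euclidean_t2)
  obtain V K where V: "open V" "compact K" "u \<in> V" "V \<subseteq> K"
    using lc by (simp add: locally_compact_space_def) blast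
  have "closed {z. z \<le> v}"
  proof -
    have "{z. z \<le> v} = {z. inf v z = z}" by (auto simp: inf.absorb_iff2)
    then show ?thesis
      by (auto intro!: closed_Collect_eq continuous_on_inf_right inf continuous_intros)
  qed
  then have "closedin euclidean (- (V - {z. z \<le> v}))" "u \<in> topspace euclidean - - (V - {z. z \<le> v})"
    using \<open>u \<in> V\<close> \<open>\<not> u \<le> v\<close> V(1) by (simp_all add: closed_Un closed_Compl flip: closed_closedin)
  moreover have "completely_regular_space (euclidean :: 'a topology)"
    using locally_compact_regular_imp_completely_regular_space lc hd by blast
  ultimately obtain h where h: "continuous_map euclidean (top_of_set {0..1::real}) h" "h u = 0"
      "h ` (- (V - {z. z \<le> v})) \<subseteq> {1}"
    unfolding completely_regular_space_def by metis
  define g where "g x = 1 - h x" for x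
  have h01: "continuous_on UNIV h" "range h \<subseteq> {0..1}"
    using h(1) by (auto simp: continuous_map_in_subtopology)
  have g: "continuous_on UNIV g" "range g \<subseteq> {0..1}" "g u = 1"
    using h01 h(2) by (auto simp: g_def intro!: continuous_intros)
  have g0: "g z = 0" if "z \<notin> V \<or> z \<le> v" for z
    using h(3) that by (auto simp: g_def)
  define F where "F x = (SUP w. g (inf w x))" for x
  have "F \<in> isotone_maps"
    unfolding F_def using isotone_sup_below[OF inf g(1,2) V(2)] g0 V(4) by blast
  moreover have "F v = 0" by (simp add: F_def g0)
  moreover have "g (inf u u) \<le> F u"
    unfolding F_def by (rule cSUP_upper) (use g(2) in \<open>force intro!: bdd_aboveI[of _ 1]\<close>)+
  ultimately show ?thesis using that g(3) by auto
qed

lemma isotone_maps_inf: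
  fixes f :: "'a::{semilattice_inf, topological_space} \<Rightarrow> real"
  assumes inf: "continuous_on UNIV (\<lambda>(x, y). inf x y :: 'a)" and "f \<in> isotone_maps"
  shows "(\<lambda>y. f (inf x y)) \<in> isotone_maps"
proof -
  have "continuous_on UNIV (\<lambda>y. f (inf x y))"
    using assms continuous_on_compose2[OF _ continuous_on_inf_right[OF inf]]
    by (auto simp: isotone_maps_def)
  moreover have "mono (\<lambda>y. f (inf x y))"
    using assms by (auto simp: isotone_maps_def intro!: monoI dest: monoD intro: inf_mono)
  ultimately show ?thesis using assms by (auto simp: isotone_maps_def)
qed

section \<open>Separating a point from the outside of a neighbourhood\<close>

text \<open>The two intervals share their least element $x \wedge y$, so their union is connected and leads
  from $x$ to $y$. Order-connectedness enters the construction here.\<close>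

lemma intervals_meet_frontier:
  fixes x y :: "'a::{semilattice_inf, topological_space}"
  assumes oc: "order_connected TYPE('a)" and "x \<in> V" "y \<notin> V"
  obtains z where "z \<in> frontier V" "inf x y \<le> z" "z \<le> x \<or> z \<le> y"
proof -
  have "connected ({inf x y..} \<inter> {..x} \<union> {inf x y..} \<inter> {..y})"
    using oc by (intro connected_Un) (auto simp: order_connected_def intro: exI[of _ "inf x y"])
  moreover have "x \<in> {inf x y..} \<inter> {..x} \<union> {inf x y..} \<inter> {..y}"
    and "y \<in> {inf x y..} \<inter> {..x} \<union> {inf x y..} \<inter> {..y}" by auto
  ultimately have "({inf x y..} \<inter> {..x} \<union> {inf x y..} \<inter> {..y}) \<inter> frontier V \<noteq> {}"
    using assms(2,3) by (intro connected_Int_frontier) blast+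
  then obtain z where "z \<in> frontier V" "z \<in> {inf x y..} \<inter> {..x} \<union> {inf x y..} \<inter> {..y}"
    by blast
  then show ?thesis by (intro that[of z]) auto
qed

text \<open>Separating $x$ from the points outside a neighbourhood $V$ one by one gives no finite
  subfamily, as the complement of $V$ need not be compact. The frontier is compact for small $V$,
  and by \<open>intervals_meet_frontier\<close> the functions found there work for all points beyond it.\<close>

lemma isotone_maps_determine_topology:
  assumes inf: "continuous_on UNIV (\<lambda>(x, y). inf x y :: 'a::{semilattice_inf, t2_space})"
    and lc: "locally_compact_space (euclidean :: 'a topology)"
    and oc: "order_connected TYPE('a)"
  shows "determines_topology (isotone_maps :: ('a \<Rightarrow> real) set)"
  unfolding determines_topology_def
proof clarify
  fix x :: 'a and U assume U: "open U" "x \<in> U"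
  have hd: "Hausdorff_space (euclidean :: 'a topology)"
    by (rule Hausdorff_space_euclidean_t2)
  obtain V K where V: "open V" "compact K" "x \<in> V" "V \<subseteq> K" "K \<subseteq> U"
    using lc U unfolding locally_compact_space_neighbourhood_base[OF disjI1[OF hd]]
      neighbourhood_base_of by (metis compactin_euclidean_iff open_openin)
  have "closure V \<subseteq> K"
    using V by (simp add: closure_minimal compact_imp_closed)
  then have "compact (frontier V)"
    using V(2) by (metis compact_Int_closed frontier_def frontier_closed Diff_subset inf.absorb2 order_trans)
  \<comment> \<open>A pair \<^term>\<open>(f, c)\<close> stands for a threshold \<^term>\<open>c\<close> that separates \<^term>\<open>x\<close> from the points
    of \<open>S (f, c)\<close>: through \<^term>\<open>f\<close> if these lie above it, through \<open>\<lambda>y. f (inf x y)\<close> if they lie below.\<close>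
  define S where "S p = (case p of (f :: 'a \<Rightarrow> real, c) \<Rightarrow>
    if f x < c then {z. c < f z} else {z. f (inf x z) < c})" for p
  define P where "P = {(f :: 'a \<Rightarrow> real, c). f \<in> isotone_maps \<and> f x \<noteq> c}"
  have opn: "open (S p)" if "p \<in> P" for p
    using that isotone_maps_inf[OF inf, of "fst p" x]
    by (auto simp: S_def P_def isotone_maps_def intro!: open_Collect_less)
  have "frontier V \<subseteq> (\<Union>p\<in>P. S p)"
  proof
    fix z assume z: "z \<in> frontier V"
    then have "z \<noteq> x" using V by (auto simp: frontier_def interior_open)
    show "z \<in> (\<Union>p\<in>P. S p)"
    proof (cases "z \<le> x")
      case False
      then obtain f where f: "f \<in> isotone_maps" "f x < f z"
        using isotone_maps_separate[OF inf lc] by blast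
      then obtain c where "f x < c" "c < f z" using dense by blast
      with f have "(f, c) \<in> P" "z \<in> S (f, c)" by (auto simp: P_def S_def)
      then show ?thesis by blast
    next
      case True
      then have "\<not> x \<le> z" using \<open>z \<noteq> x\<close> by auto
      then obtain f where f: "f \<in> isotone_maps" "f z < f x"
        using isotone_maps_separate[OF inf lc] by blast
      then obtain c where "f z < c" "c < f x" using dense by blast
      with f True have "(f, c) \<in> P" "z \<in> S (f, c)"
        by (auto simp: P_def S_def inf_absorb2)
      then show ?thesis by blast
    qed
  qed
  with \<open>compact (frontier V)\<close> opn obtain Q where Q: "Q \<subseteq> P" "finite Q" "frontier V \<subseteq> (\<Union>p\<in>Q. S p)"
    by (rule compactE_image)
  define N where "N = fst ` Q \<union> (\<lambda>f y. f (inf x y)) ` fst ` Q"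
  define e where "e = Min (insert 1 ((\<lambda>(f, c). \<bar>f x - c\<bar>) ` Q))"
  have "N \<subseteq> isotone_maps"
    using Q(1) isotone_maps_inf[OF inf] by (fastforce simp: N_def P_def)
  moreover have "finite N" using Q by (simp add: N_def)
  moreover have "e > 0"
    using Q by (auto simp: e_def P_def)
  moreover have "{y. \<forall>f\<in>N. \<bar>f y - f x\<bar> < e} \<subseteq> U"
  proof clarify
    fix y assume y: "\<forall>f\<in>N. \<bar>f y - f x\<bar> < e"
    have near: "\<bar>f y - f x\<bar> < \<bar>f x - c\<bar>" "\<bar>f (inf x y) - f x\<bar> < \<bar>f x - c\<bar>" "mono f"
      if "(f, c) \<in> Q" for f c
    proof -
      have "e \<le> \<bar>f x - c\<bar>" using Q that unfolding e_def by (intro Min_le) force+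
      moreover have "f \<in> N" "(\<lambda>y. f (inf x y)) \<in> N" using that by (force simp: N_def)+
      ultimately show "\<bar>f y - f x\<bar> < \<bar>f x - c\<bar>" "\<bar>f (inf x y) - f x\<bar> < \<bar>f x - c\<bar>"
        using y by fastforce+
      show "mono f" using that Q by (auto simp: P_def isotone_maps_def)
    qed
    have "y \<in> V"
    proof (rule ccontr)
      assume "y \<notin> V"
      then obtain z where z: "z \<in> frontier V" "inf x y \<le> z" "z \<le> x \<or> z \<le> y"
        by (rule intervals_meet_frontier[OF oc V(3)])
      then obtain f c where fc: "(f, c) \<in> Q" "z \<in> S (f, c)" using Q(3) by fastforce
      show False
      proof (cases "f x < c")
        case True
        then have "c < f z" using fc by (simp add: S_def)
        moreover have "f z \<le> f x \<or> f z \<le> f y"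
          using z(3) near(3)[OF fc(1)] by (auto dest: monoD)
        ultimately show False using near(1)[OF fc(1)] True by linarith
      next
        case False
        then have "f (inf x z) < c" using fc by (simp add: S_def)
        \<comment> \<open>Only \<open>inf x y \<le> z\<close> matters here, so it makes no difference in which interval \<^term>\<open>z\<close> lies.\<close>
        moreover have "f (inf x y) \<le> f (inf x z)"
          using z(2) near(3)[OF fc(1)] by (simp add: monoD)
        ultimately show False using near(2)[OF fc(1)] False by linarith
      qed
    qed
    then show "y \<in> U" using V by blast
  qed
  ultimately show "\<exists>N e. N \<subseteq> isotone_maps \<and> finite N \<and> e > 0 \<and> {y. \<forall>f\<in>N. \<bar>f y - f x\<bar> < e} \<subseteq> U"
    by blast
qed

section \<open>The metric of a sequence of functions\<close>

definition sum_metric :: "(nat \<Rightarrow> 'a \<Rightarrow> real) \<Rightarrow> 'a \<Rightarrow> 'a \<Rightarrow> real" where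
  "sum_metric f x y = (\<Sum>n. (1/2)^n * \<bar>f n x - f n y\<bar>)"

lemma sum_metric_summable:
  assumes "\<And>n x. f n x \<in> {0..1::real}"
  shows "summable (\<lambda>n. (1/2)^n * \<bar>f n x - f n y\<bar>)"
proof (rule summable_comparison_test')
  show "summable (\<lambda>n. (1/2::real)^n)" by (rule summable_geometric) simp
  have "\<bar>f n x - f n y\<bar> \<le> 1" for n using assms[of n x] assms[of n y] by auto
  then show "norm ((1/2)^n * \<bar>f n x - f n y\<bar>) \<le> (1/2)^n" for n
    by (simp add: abs_mult mult_left_le)
qed

lemma sum_metric_ge:
  assumes "\<And>n x. f n x \<in> {0..1::real}"
  shows "\<bar>f n x - f n y\<bar> \<le> 2^n * sum_metric f x y"
proof -
  have "(\<Sum>i\<in>{n}. (1/2)^i * \<bar>f i x - f i y\<bar>) \<le> sum_metric f x y"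
    unfolding sum_metric_def by (rule sum_le_suminf[OF sum_metric_summable[OF assms]]) auto
  then show ?thesis by (simp add: field_simps power_one_over)
qed

lemma sum_metric_le:
  assumes "\<And>n x. f n x \<in> {0..1::real}"
    and "\<And>n. \<bar>f n x - f n y\<bar> \<le> \<bar>f n u - f n v\<bar>"
  shows "sum_metric f x y \<le> sum_metric f u v"
  unfolding sum_metric_def
proof (rule suminf_le[OF _ sum_metric_summable[of f, OF assms(1)] sum_metric_summable[of f, OF assms(1)]])
  show "(1/2)^n * \<bar>f n x - f n y\<bar> \<le> (1/2)^n * \<bar>f n u - f n v\<bar>" for n
    using assms(2)[of n] by (rule mult_left_mono) simp
qed

text \<open>Balls are open because the series converges uniformly. Conversely, finitely many of the
  inequalities $|f_n(x) - f_n(y)| \le 2^n d(x,y)$ put a small ball inside any given neighbourhood,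
  and this also gives $d(x,y) > 0$ for $x \ne y$.\<close>

lemma sum_metric_metrizes:
  fixes f :: "nat \<Rightarrow> 'a::t2_space \<Rightarrow> real"
  assumes f01: "\<And>n x. f n x \<in> {0..1}" and cont: "\<And>n. continuous_on UNIV (f n)"
    and det: "determines_topology (range f)"
  shows "Metric_space UNIV (sum_metric f)"
    and "Metric_space.mtopology UNIV (sum_metric f) = euclidean"
proof -
  note sm = sum_metric_summable[of f, OF f01] and ge = sum_metric_ge[of f, OF f01]
  have nonneg: "0 \<le> sum_metric f x y" for x y
    unfolding sum_metric_def by (rule suminf_nonneg[OF sm]) simp
  have ball: "\<exists>r>0. \<forall>y. sum_metric f x y < r \<longrightarrow> y \<in> U" if U: "open U" "x \<in> U" for x U
  proof -
    obtain N e where N: "N \<subseteq> range f" "finite N" "e > 0" "{y. \<forall>g\<in>N. \<bar>g y - g x\<bar> < e} \<subseteq> U"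
      using determines_topologyD[OF det U] by blast
    then obtain I where I: "finite I" "N = f ` I" by (meson finite_subset_image)
    define r where "r = Min (insert 1 ((\<lambda>n. e / 2^n) ` I))"
    have "r > 0" using I \<open>e > 0\<close> by (auto simp: r_def)
    moreover have "y \<in> U" if y: "sum_metric f x y < r" for y
    proof -
      have "\<bar>f n y - f n x\<bar> < e" if "n \<in> I" for n
      proof -
        have "r \<le> e / 2^n" using I that unfolding r_def by (intro Min_le) auto
        then have "sum_metric f x y < e / 2^n" using y by linarith
        then have "2^n * sum_metric f x y < e" by (simp add: field_simps)
        then show ?thesis using ge[of n x y] by linarith
      qed
      then show ?thesis using N(4) I by blast
    qed
    ultimately show ?thesis by blast
  qed
  show M: "Metric_space UNIV (sum_metric f)"
  proof
    show "0 \<le> sum_metric f x y" for x y by (rule nonneg)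
    show "sum_metric f x y = sum_metric f y x" for x y
      by (simp add: sum_metric_def abs_minus_commute)
    show "sum_metric f x z \<le> sum_metric f x y + sum_metric f y z" for x y z
      unfolding sum_metric_def suminf_add[OF sm sm]
      by (intro suminf_le summable_add sm) (simp add: distrib_left[symmetric])
    show "sum_metric f x y = 0 \<longleftrightarrow> x = y" for x y
    proof
      assume 0: "sum_metric f x y = 0"
      show "x = y"
      proof (rule ccontr)
        assume "x \<noteq> y"
        then have "open (- {y})" "x \<in> - {y}" by auto
        from ball[OF this] 0 show False by (metis ComplD singletonI)
      qed
    qed (simp add: sum_metric_def)
  qed
  have "open U \<longleftrightarrow> (\<forall>x\<in>U. \<exists>r>0. \<forall>y. sum_metric f x y < r \<longrightarrow> y \<in> U)" for U
  proof
    assume r: "\<forall>x\<in>U. \<exists>r>0. \<forall>y. sum_metric f x y < r \<longrightarrow> y \<in> U"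
    show "open U"
    proof (rule Topological_Spaces.openI)
      fix x assume "x \<in> U"
      then obtain r where "r > 0" and r: "\<And>y. sum_metric f x y < r \<Longrightarrow> y \<in> U" using r by blast
      have "continuous_on UNIV (sum_metric f x)"
        unfolding sum_metric_def
      proof (rule uniform_limit_theorem)
        show "uniform_limit UNIV (\<lambda>n y. \<Sum>i<n. (1/2)^i * \<bar>f i x - f i y\<bar>)
            (\<lambda>y. \<Sum>n. (1/2)^n * \<bar>f n x - f n y\<bar>) sequentially"
        proof (rule Weierstrass_m_test)
          show "summable (\<lambda>n. (1/2::real)^n)" by (rule summable_geometric) simp
          have "\<bar>f n x - f n y\<bar> \<le> 1" for n y using f01[of n x] f01[of n y] by auto
          then show "norm ((1/2)^n * \<bar>f n x - f n y\<bar>) \<le> (1/2)^n" for n y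
            by (simp add: abs_mult mult_left_le)
        qed
      qed (auto intro!: always_eventually continuous_intros cont)
      then have "open {y. sum_metric f x y < r}"
        by (intro open_Collect_less continuous_intros)
      moreover have "sum_metric f x x = 0" by (simp add: sum_metric_def)
      ultimately show "\<exists>T. open T \<and> x \<in> T \<and> T \<subseteq> U"
        using \<open>r > 0\<close> r by (intro exI[of _ "{y. sum_metric f x y < r}"]) auto
    qed
  qed (use ball in blast)
  then show "Metric_space.mtopology UNIV (sum_metric f) = euclidean"
    by (simp add: topology_eq Metric_space.openin_mtopology[OF M] Metric_space.mball_def[OF M]
        subset_iff Ball_def flip: open_openin)
qed

lemma sum_metric_radially_convex:
  fixes f :: "nat \<Rightarrow> 'a::order \<Rightarrow> real"
  assumes f01: "\<And>n x. f n x \<in> {0..1}" and mono: "\<And>n. mono (f n)"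
  shows "radially_convex (sum_metric f)"
  unfolding radially_convex_def
proof clarify
  fix x y z :: 'a assume xyz: "x \<le> y" "y \<le> z"
  have le: "f n x \<le> f n y" "f n y \<le> f n z" for n using xyz mono by (auto dest: monoD)
  have "\<bar>f n x - f n y\<bar> \<le> \<bar>f n x - f n z\<bar>" "\<bar>f n y - f n z\<bar> \<le> \<bar>f n x - f n z\<bar>" for n
    using le[of n] by linarith+
  then have "sum_metric f x y \<le> sum_metric f x z" "sum_metric f y z \<le> sum_metric f x z"
    by (auto intro: sum_metric_le[of f, OF f01])
  then show "max (sum_metric f x y) (sum_metric f y z) \<le> sum_metric f x z" by simp
qed

theorem theorem16:
  assumes "continuous_on UNIV (\<lambda>(x, y). inf x y :: 'a::{semilattice_inf, t2_space, second_countable_topology})"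
    and "locally_compact_space (euclidean :: 'a topology)"
    and "order_connected TYPE('a)"
  shows "\<exists>d :: 'a \<Rightarrow> 'a \<Rightarrow> real. Metric_space UNIV d
           \<and> Metric_space.mtopology UNIV d = euclidean
           \<and> radially_convex d"
proof -
  have "determines_topology (isotone_maps :: ('a \<Rightarrow> real) set)"
    using isotone_maps_determine_topology assms by blast
  then obtain C :: "('a \<Rightarrow> real) set" where C: "C \<subseteq> isotone_maps" "countable C" "determines_topology C"
    using countable_determining_subfamily[of isotone_maps] by (auto simp: isotone_maps_def)
  \<comment> \<open>A constant is added because only a nonempty countable set is the range of a sequence.\<close>
  define D where "D = insert (\<lambda>_. 0) C"
  define f where "f = from_nat_into D"
  have "range f = D"
    unfolding f_def by (rule range_from_nat_into) (use C in \<open>auto simp: D_def\<close>)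
  moreover have "D \<subseteq> isotone_maps"
    using C by (auto simp: D_def isotone_maps_def mono_def)
  ultimately have f: "f n \<in> isotone_maps" for n by auto
  have "determines_topology (range f)"
    unfolding \<open>range f = D\<close> using C(3) by (rule determines_topology_mono) (auto simp: D_def)
  moreover have "f n x \<in> {0..1}" "continuous_on UNIV (f n)" "mono (f n)" for n x
    using f[of n] unfolding isotone_maps_def by blast+
  ultimately show ?thesis
    using sum_metric_metrizes[of f] sum_metric_radially_convex[of f] by blast
qed

end
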